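(* Assume $\omega_a\neq0$ and $\omega_{-b}\neq0$. Then, as formal power series in $z$ over $K$, $$\sum_{k\ge0}F_k z^k=\frac{N(z)}{D(z)},$$ where $D(z)=\det(1-z\mathbf T)$ and $N(z)$ is the $(I_0,I_0)$ cofactor of $1-z\mathbf T$ (the determinant of $1-z\mathbf T$ with row $I_0$ and column $I_0$ deleted), $I_0=[0,a-1]$. Moreover $D(z)$ has degree exactly $\binom{a+b}{a}$ and $N(z)$ has degree exactly $\binom{a+b}{a}-a-b$.
   Context: Let $S$ be a finite set of integers with $a:=\max S\ge 1$ and $b:=-\min S\ge 1$. Each $s\in S$ carries a weight $\omega_s$ in a field $K$ of characteristic $0$; set $\omega_s:=0$ for $s\in\mathbb Z\setminus S$, and for $s\in\mathbb Z$ put $\beta_s:=\delta_{s,0}-\omega_s$. For $k\ge0$, $A_k$ is the $(k+1)\times(k+1)$ matrix with rows and columns indexed by $0,\dots,k$ whose $(i,j)$ entry is $\omega_{j-i}$. Put $F_0:=1$ and $F_k:=\det(1-A_{k-1})$ for $k\ge1$. Notation: $[m,n]:=\{i\in\mathbb Z: m\le i\le n\}$, $X+c:=\{x+c:x\in X\}$; an $n$-subset is a subset of cardinality $n$. For a finite set $I\subseteq\mathbb Z$ and $s\in\mathbb Z$, $\epsilon_s(I):=(-1)^{\#\{i\in I:\ i<s\}}$. $\mathbf T$ is the square matrix with rows and columns indexed by the $a$-subsets of $[-b,a-1]$ and entries $\mathbf T[I,J]:=\epsilon_s(I)\beta_s$ if there is an integer $s$ with $I\cup\{a\}=(J+1)\cup\{s\}$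 (such $s$ is then unique), and $\mathbf T[I,J]:=0$ otherwise. *)

theory Defs
  imports "HOL-Combinatorics.Permutations" "HOL-Computational_Algebra.Polynomial_FPS"
begin

definition det_on :: "'i set \<Rightarrow> ('i \<Rightarrow> 'i \<Rightarrow> 'a::comm_ring_1) \<Rightarrow> 'a" where
  "det_on A M = (\<Sum>p | p permutes A. of_int (sign p) * (\<Prod>i\<in>A. M i (p i)))"

definition beta :: "(int \<Rightarrow> 'a::field) \<Rightarrow> int \<Rightarrow> 'a" where
  "beta \<omega> s = (if s = 0 then 1 else 0) - \<omega> s"

definition Fk :: "(int \<Rightarrow> 'a::field) \<Rightarrow> nat \<Rightarrow> 'a" where
  "Fk \<omega> k = (if k = 0 then 1 else
     det_on {0..<k} (\<lambda>i j. (if i = j then 1 else 0) - \<omega> (int j - int i)))"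

definition eps :: "int \<Rightarrow> int set \<Rightarrow> int" where
  "eps s I = (-1) ^ card {i\<in>I. i < s}"

definition Tidx :: "int \<Rightarrow> int \<Rightarrow> int set set" where
  "Tidx a b = {I. I \<subseteq> {-b..a-1} \<and> card I = nat a}"

definition Tmat :: "(int \<Rightarrow> 'a::field) \<Rightarrow> int \<Rightarrow> int set \<Rightarrow> int set \<Rightarrow> 'a" where
  "Tmat \<omega> a I J =
     (if \<exists>s. insert a I = insert s ((\<lambda>x. x + 1) ` J)
      then (let s = (THE s. insert a I = insert s ((\<lambda>x. x + 1) ` J))
            in of_int (eps s I) * beta \<omega> s)
      else 0)"

definition OneMinusZT :: "(int \<Rightarrow> 'a::field) \<Rightarrow> int \<Rightarrow> int set \<Rightarrow> int set \<Rightarrow> 'a poly" where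
  "OneMinusZT \<omega> a I J = [: (if I = J then 1 else 0), - Tmat \<omega> a I J :]"

definition Dpoly :: "(int \<Rightarrow> 'a::field) \<Rightarrow> int \<Rightarrow> int \<Rightarrow> 'a poly" where
  "Dpoly \<omega> a b = det_on (Tidx a b) (OneMinusZT \<omega> a)"

definition Npoly :: "(int \<Rightarrow> 'a::field) \<Rightarrow> int \<Rightarrow> int \<Rightarrow> 'a poly" where
  "Npoly \<omega> a b = det_on (Tidx a b - {{0..a-1}}) (OneMinusZT \<omega> a)"

end

theory Submission
  imports Defs "Jordan_Normal_Form.Determinant"
begin

text \<open>
  Expanding a banded Toeplitz determinant along its first row, the columns still available form,
  relative to the current row, an \<open>a\<close>-subset of \<open>[-b, a-1]\<close> followed by all columns from \<open>a\<close> on.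
  One expansion step is \<open>\<^bold>T\<close>, so \<open>F\<^sub>k\<close> is the \<open>(I\<^sub>0, I\<^sub>0)\<close> entry of \<open>\<^bold>T\<^sup>k\<close>, and Cramer's rule for
  \<open>1 - z\<^bold>T\<close> gives \<open>N / D\<close>.

  The matrix \<open>\<^bold>T\<close> is invertible, which gives the degree of \<open>D\<close>. At infinity \<open>N / D\<close> expands as
  \<open>-\<Sum>\<^bsub>m>0\<^esub> z\<^bsup>-m\<^esup> \<^bold>T\<^bsup>-m\<^esup>[I\<^sub>0, I\<^sub>0]\<close>. The inverse of \<open>\<^bold>T\<close> moves every element of a state down by one,
  except that an element at \<open>-b\<close> is reinserted higher up. Starting from \<open>I\<^sub>0\<close>, as long as
  \<open>0 < m < a + b\<close> some element has not been reinserted and has become negative, so the coefficient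
  vanishes; for \<open>m = a + b\<close> exactly one path returns to \<open>I\<^sub>0\<close>. Hence \<open>deg D - deg N = a + b\<close>.
\<close>

section \<open>Determinants over finite index sets\<close>

text \<open>Conjugation by the enumeration \<open>f\<close> preserves signs of permutations, so any
  order of the indices may be chosen; later a distinguished index comes first.\<close>

lemma det_on_eq_det:
  fixes M :: "'i \<Rightarrow> 'i \<Rightarrow> 'a::comm_ring_1"
  assumes f: "bij_betw f {0..<n} A"
  shows "det_on A M = det (mat n n (\<lambda>(i, j). M (f i) (f j)))"
proof -
  let ?h = "map_permutation {0..<n} f"
  have inj: "inj_on f {0..<n}" and im: "f ` {0..<n} = A"
    using f by (auto simp: bij_betw_def)
  have "bij_betw ?h {p. p permutes {0..<n}} {p. p permutes A}"
    using bij_betw_permutations[OF f]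
    by (rule bij_betw_cong[THEN iffD1, rotated])
      (auto simp: fun_eq_iff map_permutation_def restrict_id_def im)
  then have "det_on A M = (\<Sum>p | p permutes {0..<n}. of_int (sign (?h p)) * (\<Prod>i\<in>A. M i (?h p i)))"
    unfolding det_on_def by (rule sum.reindex_bij_betw[symmetric])
  also have "\<dots> = (\<Sum>p | p permutes {0..<n}. of_int (sign p) * (\<Prod>i = 0..<n. M (f i) (f (p i))))"
  proof (rule sum.cong[OF refl])
    fix p assume "p \<in> {p. p permutes {0..<n}}"
    then have p: "p permutes {0..<n}" by simp
    have "(\<Prod>i\<in>A. M i (?h p i)) = (\<Prod>i = 0..<n. M (f i) (?h p (f i)))"
      by (rule prod.reindex_bij_betw[OF f, symmetric])
    also have "\<dots> = (\<Prod>i = 0..<n. M (f i) (f (p i)))"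
      by (rule prod.cong) (auto simp: map_permutation_apply[OF inj])
    finally show "of_int (sign (?h p)) * (\<Prod>i\<in>A. M i (?h p i)) =
        of_int (sign p) * (\<Prod>i = 0..<n. M (f i) (f (p i)))"
      using sign_map_permutation[OF inj p] by simp
  qed
  also have "\<dots> = det (mat n n (\<lambda>(i, j). M (f i) (f j)))"
    by (subst det_def'[of _ n], simp)
      (intro sum.cong prod.cong refl arg_cong2[of _ _ _ _ "(*)"],
        use permutes_in_image[of _ "{0..<n}"] in auto)
  finally show ?thesis .
qed

section \<open>Determinants of matrices with entries of degree at most one\<close>

lemma degree_det_on_le:
  fixes M :: "'i \<Rightarrow> 'i \<Rightarrow> 'a::idom poly"
  assumes "finite A" and deg: "\<And>i j. i \<in> A \<Longrightarrow> j \<in> A \<Longrightarrow> degree (M i j) \<le> 1"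
  shows "degree (det_on A M) \<le> card A"
  unfolding det_on_def
proof (rule degree_sum_le)
  show "finite {p. p permutes A}" using \<open>finite A\<close> by (rule finite_permutations)
  fix p assume "p \<in> {p. p permutes A}"
  then have p: "p permutes A" by simp
  have "degree (\<Prod>i\<in>A. M i (p i)) \<le> (\<Sum>i\<in>A. degree (M i (p i)))"
    using degree_prod_sum_le[OF \<open>finite A\<close>, of "\<lambda>i. M i (p i)"] by (simp add: o_def)
  also have "\<dots> \<le> (\<Sum>i\<in>A. 1)"
    by (rule sum_mono) (use p deg in \<open>auto simp: permutes_in_image\<close>)
  finally show "degree (of_int (sign p) * (\<Prod>i\<in>A. M i (p i))) \<le> card A"
    by (cases "evenperm p") (simp_all add: sign_def)
qed

text \<open>Multiplicativity at the nominal degree \<open>card A\<close> survives vanishing linear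
  coefficients: the term with \<open>coeff (g x) 0\<close> would need a coefficient of
  \<open>prod g A\<close> beyond its degree bound.\<close>

lemma coeff_prod_card:
  fixes g :: "'i \<Rightarrow> 'a::comm_ring_1 poly"
  assumes "finite A" and "\<And>i. i \<in> A \<Longrightarrow> degree (g i) \<le> 1"
  shows "degree (prod g A) \<le> card A \<and> coeff (prod g A) (card A) = (\<Prod>i\<in>A. coeff (g i) 1)"
  using assms
proof (induction A rule: finite_induct)
  case (insert x A)
  then have IH: "degree (prod g A) \<le> card A" "coeff (prod g A) (card A) = (\<Prod>i\<in>A. coeff (g i) 1)"
    and x: "degree (g x) \<le> 1" by auto
  have "degree (g x * prod g A) \<le> 1 + card A"
    using degree_mult_le[of "g x" "prod g A"] IH(1) x by linarith
  moreover have "coeff (g x * prod g A) (1 + card A) = coeff (g x) 1 * coeff (prod g A) (card A)"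
  proof -
    have "g x = [:coeff (g x) 0, coeff (g x) 1:]"
      using x by (intro poly_eqI) (auto simp: coeff_pCons coeff_eq_0 split: nat.split)
    then have "coeff (g x * prod g A) (1 + card A) =
        coeff ([:coeff (g x) 0, coeff (g x) 1:] * prod g A) (Suc (card A))"
      by simp
    also have "\<dots> = coeff (g x) 0 * coeff (prod g A) (Suc (card A)) + coeff (g x) 1 * coeff (prod g A) (card A)"
      by (simp add: mult_pCons_left)
    also have "coeff (prod g A) (Suc (card A)) = 0"
      using IH(1) by (intro coeff_eq_0) simp
    finally show ?thesis by simp
  qed
  ultimately show ?case using insert.hyps IH(2) by simp
qed simp

lemma coeff_det_on_card:
  fixes M :: "'i \<Rightarrow> 'i \<Rightarrow> 'a::comm_ring_1 poly"
  assumes "finite A" and deg: "\<And>i j. i \<in> A \<Longrightarrow> j \<in> A \<Longrightarrow> degree (M i j) \<le> 1"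
  shows "coeff (det_on A M) (card A) = det_on A (\<lambda>i j. coeff (M i j) 1)"
  unfolding det_on_def coeff_sum
proof (rule sum.cong[OF refl])
  fix p assume "p \<in> {p. p permutes A}"
  then have p: "p permutes A" by simp
  then have "coeff (\<Prod>i\<in>A. M i (p i)) (card A) = (\<Prod>i\<in>A. coeff (M i (p i)) 1)"
    using coeff_prod_card[OF \<open>finite A\<close>, of "\<lambda>i. M i (p i)"] deg
    by (simp add: permutes_in_image)
  then show "coeff (of_int (sign p) * (\<Prod>i\<in>A. M i (p i))) (card A) =
      of_int (sign p) * (\<Prod>i\<in>A. coeff (M i (p i)) 1)"
    by (cases "evenperm p") (simp_all add: sign_def)
qed

text \<open>Multiplicativity makes the determinant a unit once a right inverse \<open>R\<close> is
  exhibited.\<close>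

lemma det_on_nonzero:
  fixes M R :: "'i \<Rightarrow> 'i \<Rightarrow> 'a::comm_ring_1"
  assumes "finite A"
    and inv: "\<And>i j. i \<in> A \<Longrightarrow> j \<in> A \<Longrightarrow> (\<Sum>l\<in>A. M i l * R l j) = (if i = j then 1 else 0)"
  shows "det_on A M \<noteq> 0"
proof -
  define n where "n = card A"
  obtain f where f: "bij_betw f {0..<n} A"
    using ex_bij_betw_nat_finite[OF \<open>finite A\<close>] by (auto simp: n_def)
  let ?P = "mat n n (\<lambda>(i, j). M (f i) (f j))" and ?Q = "mat n n (\<lambda>(i, j). R (f i) (f j))"
  have "?P * ?Q = 1\<^sub>m n"
  proof (rule eq_matI)
    fix i j assume "i < dim_row (1\<^sub>m n :: 'a mat)" "j < dim_col (1\<^sub>m n :: 'a mat)"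
    then have ij: "i < n" "j < n" by auto
    then have "(?P * ?Q) $$ (i, j) = (\<Sum>l = 0..<n. M (f i) (f l) * R (f l) (f j))"
      by (simp add: scalar_prod_def)
    also have "\<dots> = (\<Sum>l\<in>A. M (f i) l * R l (f j))"
      by (rule sum.reindex_bij_betw[OF f])
    also have "\<dots> = (if f i = f j then 1 else 0)"
      using ij bij_betw_imp_surj_on[OF f] by (intro inv) auto
    also have "\<dots> = 1\<^sub>m n $$ (i, j)"
      using ij bij_betw_imp_inj_on[OF f] by (auto simp: inj_on_def)
    finally show "(?P * ?Q) $$ (i, j) = 1\<^sub>m n $$ (i, j)" .
  qed auto
  then have "det ?P * det ?Q = 1"
    by (subst det_mult[symmetric, of _ n]) auto
  then show ?thesis using det_on_eq_det[OF f, of M] by auto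
qed

section \<open>Cramer's rule over an index set\<close>

lemma ex_bij_betw_first:
  assumes "finite A" "k \<in> A"
  obtains f where "bij_betw f {0..<card A} A" "f 0 = k"
proof -
  obtain g where g: "bij_betw g {0..<card A} A"
    using ex_bij_betw_nat_finite[OF assms(1)] by auto
  then obtain i where i: "i < card A" "g i = k"
    using assms(2) by (metis atLeastLessThan_iff bij_betw_iff_bijections)
  have "transpose 0 i permutes {0..<card A}"
    using i by (intro permutes_swap_id) auto
  then have "bij_betw (g \<circ> transpose 0 i) {0..<card A} A"
    using g by (intro bij_betw_trans[OF permutes_imp_bij])
  then show thesis by (rule that) (simp add: i)
qed

text \<open>First row of the adjugate identity applied to a vector \<open>x\<close>: Cramer's rule
  without division, usable for power series and for polynomials.\<close>

lemma det_on_mult_cofactors: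
  fixes M :: "'i \<Rightarrow> 'i \<Rightarrow> 'a::comm_ring_1"
  assumes f: "bij_betw f {0..<n} A" and "0 < n"
  shows "det_on A M * x (f 0) =
    (\<Sum>j<n. cofactor (mat n n (\<lambda>(i, j). M (f i) (f j))) j 0 * (\<Sum>l\<in>A. M (f j) l * x l))"
proof -
  let ?P = "mat n n (\<lambda>(i, j). M (f i) (f j))"
  have *: "(\<Sum>j<n. cofactor ?P j 0 * M (f j) (f l)) = (if l = 0 then det ?P else 0)" if "l < n" for l
  proof -
    have "(adj_mat ?P * ?P) $$ (0, l) = (\<Sum>j<n. cofactor ?P j 0 * M (f j) (f l))"
      using that \<open>0 < n\<close>
      by (auto simp: times_mat_def scalar_prod_def adj_mat_def atLeast0LessThan intro!: sum.cong)
    then show ?thesis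
      using that \<open>0 < n\<close> by (subst (asm) adj_mat(3)[of _ n]) auto
  qed
  have reindex: "(\<Sum>l\<in>A. M (f j) l * x l) = (\<Sum>l<n. M (f j) (f l) * x (f l))" for j
    using sum.reindex_bij_betw[OF f, of "\<lambda>l. M (f j) l * x l"]
    by (simp only: atLeast0LessThan)
  have "(\<Sum>j<n. cofactor ?P j 0 * (\<Sum>l\<in>A. M (f j) l * x l)) =
      (\<Sum>j<n. \<Sum>l<n. cofactor ?P j 0 * M (f j) (f l) * x (f l))"
    by (simp only: reindex sum_distrib_left mult.assoc)
  also have "\<dots> = (\<Sum>l<n. \<Sum>j<n. cofactor ?P j 0 * M (f j) (f l) * x (f l))"
    by (rule sum.swap)
  also have "\<dots> = (\<Sum>l<n. (\<Sum>j<n. cofactor ?P j 0 * M (f j) (f l)) * x (f l))"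
    by (simp only: sum_distrib_right)
  also have "\<dots> = (\<Sum>l<n. if l = 0 then det ?P * x (f 0) else 0)"
    by (intro sum.cong) (auto simp: *)
  also have "\<dots> = det_on A M * x (f 0)"
    using \<open>0 < n\<close> by (simp add: det_on_eq_det[OF f])
  finally show ?thesis by simp
qed

lemma cofactor_first_eq_det_on:
  fixes M :: "'i \<Rightarrow> 'i \<Rightarrow> 'a::comm_ring_1"
  assumes f: "bij_betw f {0..<n} A" and "0 < n"
  shows "cofactor (mat n n (\<lambda>(i, j). M (f i) (f j))) 0 0 = det_on (A - {f 0}) M"
proof -
  have "bij_betw Suc {0..<n - 1} ({0..<n} - {0})"
    using \<open>0 < n\<close> by (auto simp: bij_betw_def image_Suc_atLeastLessThan)
  moreover have "bij_betw f ({0..<n} - {0}) (A - {f 0})"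
    using f \<open>0 < n\<close> by (intro bij_betw_DiffI) (auto simp: bij_betw_def)
  ultimately have "bij_betw (f \<circ> Suc) {0..<n - 1} (A - {f 0})"
    by (rule bij_betw_trans)
  then show ?thesis
    unfolding cofactor_def mat_delete_def
    by (subst det_on_eq_det) (auto intro!: arg_cong[of _ _ det] eq_matI)
qed

lemma degree_cofactor_le:
  fixes P :: "'a::idom poly mat"
  assumes P: "P \<in> carrier_mat n n" and "i < n" "j < n"
    and deg: "\<And>i j. i < n \<Longrightarrow> j < n \<Longrightarrow> degree (P $$ (i, j)) \<le> 1"
  shows "degree (cofactor P i j) \<le> n - 1"
proof -
  let ?Q = "mat_delete P i j"
  have "?Q = mat (n - 1) (n - 1) (\<lambda>(r, c). ?Q $$ (id r, id c))"
    using P by (intro eq_matI) auto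
  then have "det ?Q = det_on {0..<n - 1} (\<lambda>r c. ?Q $$ (r, c))"
    using det_on_eq_det[of id "n - 1" "{0..<n - 1}" "\<lambda>r c. ?Q $$ (r, c)"] by simp
  also have "degree \<dots> \<le> card {0..<n - 1}"
    using P \<open>i < n\<close> \<open>j < n\<close> deg by (intro degree_det_on_le) (auto simp: mat_delete_def)
  finally show ?thesis
    by (cases "even (i + j)") (simp_all add: cofactor_def)
qed

lemma fps_of_poly_det_on:
  "fps_of_poly (det_on A M) = det_on A (\<lambda>i j. fps_of_poly (M i j))"
proof -
  have "fps_of_poly (of_int (sign p) * (q :: 'a poly)) = of_int (sign p) * fps_of_poly q" for p :: "'b \<Rightarrow> 'b" and q
    by (cases "evenperm p") (simp_all add: sign_def fps_of_poly_uminus)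
  then show ?thesis
    by (simp add: det_on_def fps_of_poly_sum fps_of_poly_prod)
qed

section \<open>Minors with prescribed columns\<close>

text \<open>Columns are named by integers and taken in increasing order, so deleting or shifting
  columns is an operation on the set \<open>C\<close>.\<close>

definition col_minor :: "nat \<Rightarrow> (nat \<Rightarrow> int \<Rightarrow> 'a) \<Rightarrow> int set \<Rightarrow> 'a::comm_ring_1" where
  "col_minor n E C = det (mat n n (\<lambda>(r, c). E r (sorted_list_of_set C ! c)))"

lemma col_minor_cong:
  assumes "finite C" "card C = n" and "\<And>r c. r < n \<Longrightarrow> c \<in> C \<Longrightarrow> E r c = E' r c"
  shows "col_minor n E C = col_minor n E' C"
proof -
  have "sorted_list_of_set C ! j \<in> C" if "j < n" for j
    using nth_mem[of j "sorted_list_of_set C"] assms(1,2) that by simp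
  then show ?thesis
    unfolding col_minor_def using assms(3) by (intro arg_cong[of _ _ det] eq_matI) auto
qed

lemma col_minor_zero_column:
  assumes "finite C" "card C = n" "c \<in> C" and zero: "\<And>r. r < n \<Longrightarrow> E r c = 0"
  shows "col_minor n E C = 0"
proof -
  obtain j where j: "j < n" "sorted_list_of_set C ! j = c"
    using assms(1-3) in_set_conv_nth[of c "sorted_list_of_set C"] by auto
  show ?thesis
    unfolding col_minor_def
    by (subst laplace_expansion_column[of _ n j]) (use j zero in auto)
qed

lemma col_minor_zero_row:
  assumes "finite C" "card C = n" "r < n" and zero: "\<And>c. c \<in> C \<Longrightarrow> E r c = 0"
  shows "col_minor n E C = 0"
proof -
  have "sorted_list_of_set C ! j \<in> C" if "j < n" for j
    using nth_mem[of j "sorted_list_of_set C"] assms(1,2) that by simp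
  then show ?thesis
    unfolding col_minor_def
    by (subst laplace_expansion_row[of _ n r]) (use assms in auto)
qed

lemma col_minor_pred_image:
  assumes "finite C" "card C = n"
  shows "col_minor n E ((\<lambda>x. x - 1) ` C) = col_minor n (\<lambda>r c. E r (c - 1)) C"
proof -
  have "sorted_list_of_set ((\<lambda>x. x - 1) ` C) = map (\<lambda>x. x - 1) (sorted_list_of_set C)"
    using assms(1)
    by (intro sorted_list_of_set_unique[THEN iffD1])
      (auto simp: sorted_wrt_map card_image inj_on_def)
  then show ?thesis
    unfolding col_minor_def using assms by (intro arg_cong[of _ _ det] eq_matI) auto
qed

text \<open>The position of \<open>s\<close> in the increasing list of columns is the number of
  smaller elements, so Laplace expansion along the first row produces the sign pattern of
  \<open>eps\<close>.\<close>

lemma col_minor_Suc: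
  assumes "finite C" "card C = Suc n"
  shows "col_minor (Suc n) E C =
    (\<Sum>s\<in>C. (- 1) ^ card {c\<in>C. c < s} * E 0 s * col_minor n (\<lambda>r. E (Suc r)) (C - {s}))"
proof -
  define xs where "xs = sorted_list_of_set C"
  have len: "length xs = Suc n" and set: "set xs = C" and strict: "sorted_wrt (<) xs"
    and dist: "distinct xs"
    using assms by (auto simp: xs_def)
  have bij: "bij_betw ((!) xs) {..<Suc n} C"
    using bij_betw_nth[OF dist, of "{..<Suc n}" C] len set by auto
  let ?A = "mat (Suc n) (Suc n) (\<lambda>(r, c). E r (xs ! c))"
  have expand: "?A $$ (0, j) * cofactor ?A 0 j =
      (- 1) ^ card {c\<in>C. c < xs ! j} * E 0 (xs ! j) * col_minor n (\<lambda>r. E (Suc r)) (C - {xs ! j})"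
    if j: "j < Suc n" for j
  proof -
    have "{c\<in>C. c < xs ! j} = (!) xs ` {..<j}"
    proof (intro equalityI subsetI)
      fix c assume c: "c \<in> {c\<in>C. c < xs ! j}"
      then obtain i where i: "i < Suc n" "c = xs ! i"
        using set len by (auto simp: in_set_conv_nth)
      have "i < j"
      proof (rule ccontr)
        assume "\<not> i < j"
        then have "xs ! j \<le> xs ! i"
          using sorted_wrt_nth_less[OF strict, of j i] i len by (cases "i = j") auto
        with c i show False by simp
      qed
      with i show "c \<in> (!) xs ` {..<j}" by simp
    next
      fix c assume "c \<in> (!) xs ` {..<j}"
      then show "c \<in> {c\<in>C. c < xs ! j}"
        using sorted_wrt_nth_less[OF strict] j len set by fastforce
    qed
    moreover have "inj_on ((!) xs) {..<j}"
      using bij j by (auto simp: bij_betw_def intro: inj_on_subset)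
    ultimately have card: "card {c\<in>C. c < xs ! j} = j"
      by (simp add: card_image)
    have "sorted_list_of_set (C - {xs ! j}) = remove1 (xs ! j) xs"
      using sorted_list_of_set_remove[OF assms(1)] by (simp add: xs_def)
    also have "\<dots> = take j xs @ drop (Suc j) xs"
    proof -
      have "xs ! j \<notin> set (take j xs)"
        using dist j len by (auto simp: in_set_conv_nth nth_eq_iff_index_eq)
      moreover have "xs = take j xs @ xs ! j # drop (Suc j) xs"
        using j len by (simp add: id_take_nth_drop)
      ultimately show ?thesis
        by (metis remove1.simps(2) remove1_append)
    qed
    finally have rem: "sorted_list_of_set (C - {xs ! j}) = take j xs @ drop (Suc j) xs" .
    have "mat_delete ?A 0 j = mat n n (\<lambda>(r, c). E (Suc r) (sorted_list_of_set (C - {xs ! j}) ! c))"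
      using j len by (intro eq_matI) (auto simp: mat_delete_def rem nth_append min_def)
    then show ?thesis
      using j by (simp add: cofactor_def card col_minor_def)
  qed
  have "col_minor (Suc n) E C = (\<Sum>j<Suc n. ?A $$ (0, j) * cofactor ?A 0 j)"
    unfolding col_minor_def xs_def[symmetric] by (rule laplace_expansion_row) auto
  also have "\<dots> = (\<Sum>j<Suc n. (- 1) ^ card {c\<in>C. c < xs ! j} * E 0 (xs ! j) *
      col_minor n (\<lambda>r. E (Suc r)) (C - {xs ! j}))"
    by (intro sum.cong refl expand) simp
  also have "\<dots> = (\<Sum>s\<in>C. (- 1) ^ card {c\<in>C. c < s} * E 0 s * col_minor n (\<lambda>r. E (Suc r)) (C - {s}))"
    by (rule sum.reindex_bij_betw[OF bij])
  finally show ?thesis .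
qed

section \<open>The transfer matrix\<close>

text \<open>Columns are named relative to the current row. That row can use only
  \<open>insert a I\<close>, its entries beyond \<open>a\<close> being zero; after \<open>s\<close>
  is used, the next row sees the remaining columns one lower.\<close>

definition next_state :: "int \<Rightarrow> int set \<Rightarrow> int \<Rightarrow> int set" where
  "next_state a I s = (\<lambda>x. x - 1) ` (insert a I - {s})"

lemma mem_next_state: "x \<in> next_state a I s \<longleftrightarrow> x + 1 \<in> insert a I - {s}"
proof
  assume "x + 1 \<in> insert a I - {s}"
  then have "x + 1 - 1 \<in> next_state a I s" unfolding next_state_def by (rule imageI)
  then show "x \<in> next_state a I s" by simp
qed (auto simp: next_state_def)

lemma Tidx_iff: "I \<in> Tidx a b \<longleftrightarrow> I \<subseteq> {- b..a - 1} \<and> card I = nat a"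
  by (simp add: Tidx_def)

lemma finite_Tidx [simp]: "finite (Tidx a b)"
  by (rule finite_subset[of _ "Pow {- b..a - 1}"]) (auto simp: Tidx_def)

lemma TidxD:
  assumes "I \<in> Tidx a b"
  shows "finite I" "a \<notin> I" "card I = nat a" "x \<in> I \<Longrightarrow> - b \<le> x \<and> x < a"
  using assms finite_subset[of I "{- b..a - 1}"] by (auto simp: Tidx_def)

lemma succ_image_next_state: "(\<lambda>x. x + 1) ` next_state a I s = insert a I - {s}"
  by (simp add: next_state_def image_image)

lemma Tmat_next_state:
  assumes "s \<in> insert a I"
  shows "Tmat \<omega> a I (next_state a I s) = of_int (eps s I) * beta \<omega> s"
proof -
  have "insert a I = insert t ((\<lambda>x. x + 1) ` next_state a I s) \<longleftrightarrow> t = s" for t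
  proof
    assume "insert a I = insert t ((\<lambda>x. x + 1) ` next_state a I s)"
    then have "s \<in> insert t (insert a I - {s})"
      using assms by (simp only: succ_image_next_state)
    then show "t = s" by simp
  qed (use insert_Diff[OF assms] in \<open>simp only: succ_image_next_state\<close>)
  then show ?thesis by (simp add: Tmat_def)
qed

text \<open>Counting: \<open>insert a I\<close> has one element more than \<open>J\<close> shifted
  up, so an \<open>s\<close> as in \<open>Tmat\<close> lies outside that shift, and removing it
  recovers \<open>J\<close>.\<close>

lemma Tmat_eq_0:
  assumes I: "I \<in> Tidx a b" and J: "J \<in> Tidx a b" and "0 \<le> a" "J \<notin> next_state a I ` insert a I"
  shows "Tmat \<omega> a I J = 0"
proof -
  have False if s: "insert a I = insert s ((\<lambda>x. x + 1) ` J)" for s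
  proof -
    let ?K = "(\<lambda>x. x + 1) ` J"
    have "card ?K = nat a" "finite ?K"
      using TidxD[OF J] by (simp_all add: card_image)
    moreover have "card (insert a I) = Suc (nat a)"
      using TidxD[OF I] by simp
    ultimately have "s \<notin> ?K"
      using s by (metis insert_absorb n_not_Suc_n)
    with s have "insert a I - {s} = ?K" by blast
    then have "next_state a I s = J"
      by (simp add: next_state_def image_image)
    with s assms(4) show False by blast
  qed
  then have "\<not> (\<exists>s. insert a I = insert s ((\<lambda>x. x + 1) ` J))" by blast
  then show ?thesis unfolding Tmat_def by (rule if_not_P)
qed

lemma sum_Tmat:
  fixes f :: "int set \<Rightarrow> 'a::field"
  assumes I: "I \<in> Tidx a b" and "0 \<le> a"
  shows "(\<Sum>J\<in>Tidx a b. Tmat \<omega> a I J * f J) =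
    (\<Sum>s | s \<in> insert a I \<and> next_state a I s \<in> Tidx a b.
      of_int (eps s I) * beta \<omega> s * f (next_state a I s))"
proof -
  let ?S = "{s. s \<in> insert a I \<and> next_state a I s \<in> Tidx a b}"
  have inj: "inj_on (next_state a I) ?S"
  proof (rule inj_onI)
    fix s t assume "s \<in> ?S" "t \<in> ?S" "next_state a I s = next_state a I t"
    then have "insert a I - {s} = insert a I - {t}"
      by (metis succ_image_next_state)
    then show "s = t" using \<open>s \<in> ?S\<close> by blast
  qed
  have "(\<Sum>J\<in>Tidx a b. Tmat \<omega> a I J * f J) = (\<Sum>J\<in>next_state a I ` ?S. Tmat \<omega> a I J * f J)"
    by (rule sum.mono_neutral_right) (auto intro!: Tmat_eq_0[OF I] \<open>0 \<le> a\<close>)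
  also have "\<dots> = (\<Sum>s\<in>?S. Tmat \<omega> a I (next_state a I s) * f (next_state a I s))"
    using sum.reindex[OF inj, of "\<lambda>J. Tmat \<omega> a I J * f J"] by (simp only: o_def)
  also have "\<dots> = (\<Sum>s\<in>?S. of_int (eps s I) * beta \<omega> s * f (next_state a I s))"
    by (intro sum.cong refl) (simp add: Tmat_next_state)
  finally show ?thesis .
qed

text \<open>The shift leaves the window only if an element \<open>-b\<close> is kept, so a state
  containing \<open>-b\<close> has just one admissible move.\<close>

lemma next_state_in_Tidx_iff:
  assumes I: "I \<in> Tidx a b" and "- b < a" and s: "s \<in> insert a I"
  shows "next_state a I s \<in> Tidx a b \<longleftrightarrow> (- b \<in> I \<longrightarrow> s = - b)"
proof
  assume "next_state a I s \<in> Tidx a b"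
  then have "- b - 1 \<notin> next_state a I s" by (auto dest: TidxD(4))
  then show "- b \<in> I \<longrightarrow> s = - b" by (auto simp: mem_next_state)
next
  assume *: "- b \<in> I \<longrightarrow> s = - b"
  have "next_state a I s \<subseteq> {- b..a - 1}"
  proof
    fix x assume "x \<in> next_state a I s"
    then have x: "x + 1 \<in> insert a I" "x + 1 \<noteq> s" by (auto simp: mem_next_state)
    then have "x + 1 \<noteq> - b" using * \<open>- b < a\<close> by auto
    with x TidxD(4)[OF I, of "x + 1"] \<open>- b < a\<close> show "x \<in> {- b..a - 1}" by auto
  qed
  moreover have "card (next_state a I s) = nat a"
    using TidxD[OF I] s by (simp add: next_state_def card_image inj_on_def card_Diff_singleton)
  ultimately show "next_state a I s \<in> Tidx a b" by (simp add: Tidx_iff)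
qed

lemma card_Tidx:
  assumes "0 \<le> a" "0 \<le> b"
  shows "card (Tidx a b) = nat (a + b) choose nat a"
  unfolding Tidx_def using n_subsets[of "{- b..a - 1}" "nat a"] assms by simp

section \<open>Toeplitz minors as walks between states\<close>

locale walk =
  fixes \<omega> :: "int \<Rightarrow> 'a::field" and a b :: int
  assumes a_pos: "1 \<le> a" and b_pos: "1 \<le> b"
    and omega_outside: "s < - b \<or> a < s \<Longrightarrow> \<omega> s = 0"
    and omega_max: "\<omega> a \<noteq> 0" and omega_min: "\<omega> (- b) \<noteq> 0"
begin

abbreviation "I\<^sub>0 \<equiv> {0..a - 1}"

lemma beta_outside: "s < - b \<or> a < s \<Longrightarrow> beta \<omega> s = 0"
  using omega_outside[of s] a_pos b_pos by (auto simp: beta_def)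

lemma beta_max: "beta \<omega> a \<noteq> 0" and beta_min: "beta \<omega> (- b) \<noteq> 0"
  using omega_max omega_min a_pos b_pos by (auto simp: beta_def)

lemma I0_in_Tidx: "I\<^sub>0 \<in> Tidx a b"
  using a_pos b_pos by (auto simp: Tidx_iff)

text \<open>Rows \<open>r < k\<close> are Toeplitz rows \<open>\<beta>\<^bsub>c - r\<^esub>\<close>; the last \<open>a\<close> rows are unit vectors, which
  force the columns left over after \<open>k\<close> expansion steps to be \<open>k, \<dots>, k + a - 1\<close>.\<close>

definition bordered :: "nat \<Rightarrow> nat \<Rightarrow> int \<Rightarrow> 'a" where
  "bordered k r c = (if r < k then beta \<omega> (c - int r) else if c = int r then 1 else 0)"

text \<open>For \<open>I\<close> in \<open>Tidx a b\<close> this is the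
  \<open>(I, I\<^sub>0)\<close> entry of the \<open>k\<close>-th power of T. The adjoined columns
  are those that \<open>k\<close> expansion steps can newly reach.\<close>

definition state_minor :: "nat \<Rightarrow> int set \<Rightarrow> 'a" where
  "state_minor k I = col_minor (k + nat a) (bordered k) (I \<union> {a..<a + int k})"

lemma card_columns:
  assumes "finite I" "card I = nat a" "\<And>x. x \<in> I \<Longrightarrow> x < a"
  shows "card (I \<union> {a..<a + int k}) = k + nat a"
  using assms by (subst card_Un_disjoint) force+

text \<open>Only unit rows remain. They form the identity for \<open>I\<^sub>0\<close>; any other
  state misses an element of \<open>I\<^sub>0\<close>, whose row is then zero.\<close>

lemma state_minor_0:
  assumes I: "I \<in> Tidx a b"
  shows "state_minor 0 I = (if I = I\<^sub>0 then 1 else 0)"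
proof (cases "I = I\<^sub>0")
  case True
  have "sorted_list_of_set I\<^sub>0 = [0..a - 1]"
    by (rule sorted_list_of_set_unique[THEN iffD1]) auto
  then have "mat (nat a) (nat a) (\<lambda>(r, c). bordered 0 r (sorted_list_of_set I\<^sub>0 ! c)) = 1\<^sub>m (nat a)"
    by (intro eq_matI) (auto simp: bordered_def)
  with True show ?thesis by (simp add: state_minor_def col_minor_def)
next
  case False
  note I' = TidxD[OF I]
  have "\<not> I\<^sub>0 \<subseteq> I"
    using False card_subset_eq[of I "I\<^sub>0"] I' by auto
  then obtain r where r: "r \<in> I\<^sub>0" "r \<notin> I" by blast
  have "state_minor 0 I = 0"
    unfolding state_minor_def
  proof (rule col_minor_zero_row[where r = "nat r"])
    show "bordered 0 (nat r) c = 0" if "c \<in> I \<union> {a..<a + int 0}" for c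
      using r that by (auto simp: bordered_def)
  qed (use r I' in auto)
  with False show ?thesis by simp
qed

text \<open>Column \<open>-b - 1\<close> is zero: its Toeplitz entries have index below
  \<open>-b\<close>, and the unit rows have their 1 in a nonnegative column. This discards moves
  that leave the window.\<close>

lemma state_minor_eq_0:
  assumes "finite I" "card I = nat a" "\<And>x. x \<in> I \<Longrightarrow> x < a" and "- b - 1 \<in> I"
  shows "state_minor k I = 0"
  unfolding state_minor_def
proof (rule col_minor_zero_column[where c = "- b - 1"])
  show "bordered k r (- b - 1) = 0" for r
    using b_pos by (auto simp: bordered_def intro!: beta_outside)
qed (use assms card_columns in auto)

lemma state_minor_Suc:
  assumes I: "I \<in> Tidx a b"
  shows "state_minor (Suc k) I = (\<Sum>J\<in>Tidx a b. Tmat \<omega> a I J * state_minor k J)"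
proof -
  note I' = TidxD[OF I]
  let ?C = "I \<union> {a..<a + int (Suc k)}"
  have card: "card ?C = Suc (k + nat a)"
    using card_columns[of I "Suc k"] I' by simp
  \<comment> \<open>Deleting the first row lowers the row numbers by one. Lowering the column names
    as well preserves \<open>c - r\<close> and leaves \<open>k\<close> Toeplitz rows above the same
    unit rows.\<close>
  have minor: "col_minor (k + nat a) (\<lambda>r. bordered (Suc k) (Suc r)) (?C - {s}) =
      state_minor k (next_state a I s)" if s: "s \<in> insert a I" for s
  proof -
    have "next_state a I s \<union> {a..<a + int k} = (\<lambda>x. x - 1) ` (?C - {s})"
    proof (rule Set.set_eqI)
      fix x
      have "x \<in> (\<lambda>x. x - 1) ` (?C - {s}) \<longleftrightarrow> x + 1 \<in> ?C - {s}"
        by (force simp: image_iff)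
      also have "\<dots> \<longleftrightarrow> x \<in> next_state a I s \<union> {a..<a + int k}"
        using s I'(4)[of s] by (auto simp: mem_next_state)
      finally show "x \<in> next_state a I s \<union> {a..<a + int k} \<longleftrightarrow> x \<in> (\<lambda>x. x - 1) ` (?C - {s})" ..
    qed
    moreover have C: "finite (?C - {s})" "card (?C - {s}) = k + nat a"
    proof -
      show "finite (?C - {s})" using I'(1) by simp
      have "s \<in> ?C" using s by auto
      then show "card (?C - {s}) = k + nat a" using card by (simp only: card_Diff_singleton)
    qed
    ultimately have "state_minor k (next_state a I s) =
        col_minor (k + nat a) (\<lambda>r c. bordered k r (c - 1)) (?C - {s})"
      unfolding state_minor_def by (simp only: col_minor_pred_image)
    also have "\<dots> = col_minor (k + nat a) (\<lambda>r. bordered (Suc k) (Suc r)) (?C - {s})"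
    proof (rule col_minor_cong[OF C])
      show "bordered k r (c - 1) = bordered (Suc k) (Suc r) c" for r c
        by (simp add: bordered_def algebra_simps)
    qed
    finally show ?thesis ..
  qed
  have "state_minor (Suc k) I = (\<Sum>s\<in>?C. (- 1) ^ card {c\<in>?C. c < s} * bordered (Suc k) 0 s *
      col_minor (k + nat a) (\<lambda>r. bordered (Suc k) (Suc r)) (?C - {s}))"
    unfolding state_minor_def using col_minor_Suc[OF _ card] I'(1) by simp
  also have "\<dots> = (\<Sum>s\<in>insert a I. (- 1) ^ card {c\<in>?C. c < s} * bordered (Suc k) 0 s *
      col_minor (k + nat a) (\<lambda>r. bordered (Suc k) (Suc r)) (?C - {s}))"
    by (rule sum.mono_neutral_right) (use I'(1) in \<open>auto simp: bordered_def beta_outside\<close>)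
  also have "\<dots> = (\<Sum>s\<in>insert a I. of_int (eps s I) * beta \<omega> s * state_minor k (next_state a I s))"
  proof (rule sum.cong[OF refl])
    fix s assume s: "s \<in> insert a I"
    \<comment> \<open>As \<open>s\<close> is at most \<open>a\<close>, no adjoined column lies below
      it, so the Laplace sign is \<open>eps s I\<close>.\<close>
    have "{c\<in>?C. c < s} = {i\<in>I. i < s}"
      using s I'(4)[of s] by auto
    then show "(- 1) ^ card {c\<in>?C. c < s} * bordered (Suc k) 0 s *
        col_minor (k + nat a) (\<lambda>r. bordered (Suc k) (Suc r)) (?C - {s}) =
      of_int (eps s I) * beta \<omega> s * state_minor k (next_state a I s)"
      using minor[OF s] by (simp add: bordered_def eps_def)
  qed
  also have "\<dots> = (\<Sum>s | s \<in> insert a I \<and> next_state a I s \<in> Tidx a b.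
      of_int (eps s I) * beta \<omega> s * state_minor k (next_state a I s))"
  proof (rule sum.mono_neutral_right)
    show "\<forall>s\<in>insert a I - {s. s \<in> insert a I \<and> next_state a I s \<in> Tidx a b}.
        of_int (eps s I) * beta \<omega> s * state_minor k (next_state a I s) = 0"
    proof
      fix s assume "s \<in> insert a I - {s. s \<in> insert a I \<and> next_state a I s \<in> Tidx a b}"
      then have s: "s \<in> insert a I" "- b \<in> I" "s \<noteq> - b"
        using next_state_in_Tidx_iff[OF I, of s] a_pos b_pos by auto
      have "state_minor k (next_state a I s) = 0"
      proof (rule state_minor_eq_0)
        show "card (next_state a I s) = nat a"
          using I' s by (simp add: next_state_def card_image inj_on_def card_Diff_singleton)
        show "x < a" if "x \<in> next_state a I s" for x
          using that I'(4)[of "x + 1"] by (auto simp: mem_next_state)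
        show "finite (next_state a I s)"
          using I'(1) by (simp add: next_state_def)
        show "- b - 1 \<in> next_state a I s"
          using s by (simp add: mem_next_state)
      qed
      then show "of_int (eps s I) * beta \<omega> s * state_minor k (next_state a I s) = 0" by simp
    qed
  qed (use I'(1) in auto)
  also have "\<dots> = (\<Sum>J\<in>Tidx a b. Tmat \<omega> a I J * state_minor k J)"
    using a_pos by (intro sum_Tmat[OF I, symmetric]) simp
  finally show ?thesis .
qed

text \<open>With columns \<open>0, ..., k + a - 1\<close> the matrix is block upper triangular, its
  diagonal blocks being the Toeplitz matrix of \<open>Fk\<close> and an identity.\<close>

lemma state_minor_I0: "state_minor k I\<^sub>0 = Fk \<omega> k"
proof -
  have C: "I\<^sub>0 \<union> {a..<a + int k} = {0..a + int k - 1}"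
    using a_pos by auto
  have "sorted_list_of_set {0..a + int k - 1} = [0..a + int k - 1]"
    by (rule sorted_list_of_set_unique[THEN iffD1]) auto
  moreover have "[0..a + int k - 1] ! j = int j" if "j < k + nat a" for j
    using that a_pos by (subst nth_upto) simp_all
  ultimately have "state_minor k I\<^sub>0 = det (mat (k + nat a) (k + nat a) (\<lambda>(r, c). bordered k r (int c)))"
    unfolding state_minor_def col_minor_def C
    by (intro arg_cong[of _ _ det] eq_matI) auto
  also have "mat (k + nat a) (k + nat a) (\<lambda>(r, c). bordered k r (int c)) =
      four_block_mat (mat k k (\<lambda>(i, j). beta \<omega> (int j - int i)))
        (mat k (nat a) (\<lambda>(i, j). beta \<omega> (int (k + j) - int i))) (0\<^sub>m (nat a) k) (1\<^sub>m (nat a))"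
    by (intro eq_matI) (auto simp: bordered_def four_block_mat_def Let_def)
  also have "det \<dots> = det (mat k k (\<lambda>(i, j). beta \<omega> (int j - int i)))"
    by (subst det_four_block_mat_lower_left_zero[of _ k _ "nat a"]) auto
  also have "\<dots> = det_on {0..<k} (\<lambda>i j. beta \<omega> (int j - int i))"
    using det_on_eq_det[of id k "{0..<k}" "\<lambda>i j. beta \<omega> (int j - int i)"] by simp
  also have "(\<lambda>i j. beta \<omega> (int j - int i)) = (\<lambda>i j. (if i = j then 1 else 0) - \<omega> (int j - int i))"
    by (auto simp: beta_def fun_eq_iff)
  \<comment> \<open>For \<open>k = 0\<close> the determinant over the empty index set is 1, which
    agrees with the separate clause of \<open>Fk\<close>.\<close>
  also have "det_on {0..<k} \<dots> = Fk \<omega> k"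
    by (auto simp: Fk_def det_on_def)
  finally show ?thesis .
qed

text \<open>A row of \<open>\<^bold>T\<close> indexed by \<open>I \<ni> -b\<close> has a single entry, in a column \<open>J \<ni> a - 1\<close>; once those
  unknowns are known, a row with \<open>-b \<notin> I\<close> determines the unknown at \<open>J = I - 1\<close>. This solves
  \<open>\<^bold>T y = v\<close> explicitly.\<close>

definition retract :: "(int set \<Rightarrow> 'a) \<Rightarrow> int set \<Rightarrow> 'a" where
  "retract v J = (let K = (\<lambda>x. x + 1) ` J in
     if a - 1 \<in> J then v (insert (- b) (K - {a})) / beta \<omega> (- b)
     else (v K - (\<Sum>s\<in>K. of_int (eps s K) * beta \<omega> s * (v (insert (- b) (K - {s})) / beta \<omega> (- b)))) /
       ((- 1) ^ nat a * beta \<omega> a))"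

lemma Tmat_retract:
  assumes I: "I \<in> Tidx a b"
  shows "(\<Sum>J\<in>Tidx a b. Tmat \<omega> a I J * retract v J) = v I"
proof -
  note I' = TidxD[OF I]
  have ab: "- b < a" using a_pos b_pos by simp
  have sum: "(\<Sum>J\<in>Tidx a b. Tmat \<omega> a I J * retract v J) =
      (\<Sum>s | s \<in> insert a I \<and> (- b \<in> I \<longrightarrow> s = - b).
        of_int (eps s I) * beta \<omega> s * retract v (next_state a I s))"
  proof -
    have "{s. s \<in> insert a I \<and> next_state a I s \<in> Tidx a b} = {s. s \<in> insert a I \<and> (- b \<in> I \<longrightarrow> s = - b)}"
      by (intro Collect_cong conj_cong refl next_state_in_Tidx_iff[OF I ab])
    then show ?thesis using sum_Tmat[OF I, of \<omega> "retract v"] a_pos by (simp only:)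
  qed
  \<comment> \<open>A move with \<open>s\<close> in \<open>I\<close> keeps column \<open>a\<close>,
    which becomes \<open>a - 1\<close>, so the first branch of \<open>retract\<close>
    applies.\<close>
  have retract_next: "retract v (next_state a I s) = v (insert (- b) (I - {s})) / beta \<omega> (- b)"
    if "s \<in> I" for s
  proof -
    have "a - 1 \<in> next_state a I s"
      using that I'(2) by (auto simp: mem_next_state)
    moreover have "insert a I - {s} - {a} = I - {s}" using I'(2) by blast
    ultimately show ?thesis by (simp only: retract_def Let_def succ_image_next_state if_True)
  qed
  show ?thesis
  proof (cases "- b \<in> I")
    case True
    then have "{s. s \<in> insert a I \<and> (- b \<in> I \<longrightarrow> s = - b)} = {- b}" by auto
    moreover have "{i\<in>I. i < - b} = {}" using I'(4) by force
    then have "eps (- b) I = 1" by (simp only: eps_def card.empty power_0)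
    moreover have "insert (- b) (I - {- b}) = I" using True by blast
    ultimately show ?thesis
      unfolding sum using retract_next[OF True] beta_min by simp
  next
    case False
    then have S: "{s. s \<in> insert a I \<and> (- b \<in> I \<longrightarrow> s = - b)} = insert a I" by auto
    \<comment> \<open>The move \<open>s = a\<close> alone leads to a state without
      \<open>a - 1\<close>. Its sign is \<open>(-1)^a\<close>, as all of \<open>I\<close> lies below
      \<open>a\<close>; the sum subtracted in \<open>retract\<close> cancels the other
      moves.\<close>
    have "{i\<in>I. i < a} = I" using I'(4) by auto
    then have eps_a: "eps a I = (- 1) ^ nat a" using I'(3) by (simp add: eps_def)
    have "a - 1 \<notin> next_state a I a" by (simp add: mem_next_state)
    moreover have "insert a I - {a} = I" using I'(2) by blast
    ultimately have "retract v (next_state a I a) =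
        (v I - (\<Sum>s\<in>I. of_int (eps s I) * beta \<omega> s * (v (insert (- b) (I - {s})) / beta \<omega> (- b)))) /
          ((- 1) ^ nat a * beta \<omega> a)"
      by (simp only: retract_def Let_def succ_image_next_state if_False)
    then have "of_int (eps a I) * beta \<omega> a * retract v (next_state a I a) =
        v I - (\<Sum>s\<in>I. of_int (eps s I) * beta \<omega> s * (v (insert (- b) (I - {s})) / beta \<omega> (- b)))"
      using beta_max by (simp add: eps_a)
    also have "\<dots> = v I - (\<Sum>s\<in>I. of_int (eps s I) * beta \<omega> s * retract v (next_state a I s))"
      using retract_next by simp
    finally show ?thesis
      unfolding sum S using I'(1,2) by simp
  qed
qed

abbreviation "unit_vec_I\<^sub>0 \<equiv> (\<lambda>I. if I = I\<^sub>0 then 1 else 0 :: 'a)"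

section \<open>Degree of the denominator and the generating function\<close>

lemma degree_OneMinusZT: "degree (OneMinusZT \<omega> a I J) \<le> 1"
  by (simp add: OneMinusZT_def)

text \<open>The coefficient at the maximal possible degree is the determinant of -T, and
  \<open>retract\<close> applied to unit vectors supplies, up to sign, a right inverse.\<close>

lemma degree_Dpoly: "degree (Dpoly \<omega> a b) = card (Tidx a b)"
proof (rule antisym)
  show "degree (Dpoly \<omega> a b) \<le> card (Tidx a b)"
    unfolding Dpoly_def by (intro degree_det_on_le finite_Tidx degree_OneMinusZT)
  have "coeff (Dpoly \<omega> a b) (card (Tidx a b)) = det_on (Tidx a b) (\<lambda>I J. - Tmat \<omega> a I J)"
    unfolding Dpoly_def
    by (subst coeff_det_on_card[OF finite_Tidx degree_OneMinusZT]) (simp add: OneMinusZT_def)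
  also have "\<dots> \<noteq> 0"
  proof (rule det_on_nonzero)
    fix I J assume "I \<in> Tidx a b"
    then show "(\<Sum>K\<in>Tidx a b. - Tmat \<omega> a I K * - retract (\<lambda>L. if L = J then 1 else 0) K) =
        (if I = J then 1 else 0)"
      using Tmat_retract[of I "\<lambda>L. if L = J then 1 else 0"] by simp
  qed simp
  finally show "card (Tidx a b) \<le> degree (Dpoly \<omega> a b)" by (rule le_degree)
qed

lemma Dpoly_nonzero: "Dpoly \<omega> a b \<noteq> 0"
proof
  assume "Dpoly \<omega> a b = 0"
  then have "card (Tidx a b) = 0" using degree_Dpoly by simp
  then show False using I0_in_Tidx by auto
qed

text \<open>The series \<open>X I\<close> of the minors \<open>state_minor k I\<close> solve
  \<open>(1 - zT) X = e\<close> with \<open>e\<close> the unit vector at \<open>I\<^sub>0\<close>: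
  coefficientwise this is their recursion and initial value. Cramer's rule isolates the component at
  \<open>I\<^sub>0\<close>.\<close>

lemma generating_function:
  "Abs_fps (Fk \<omega>) = fps_of_poly (Npoly \<omega> a b) / fps_of_poly (Dpoly \<omega> a b)"
proof -
  let ?A = "Tidx a b" and ?M = "\<lambda>I J. fps_of_poly (OneMinusZT \<omega> a I J)"
  define X where "X I = Abs_fps (\<lambda>k. state_minor k I)" for I
  have sol: "(\<Sum>J\<in>?A. ?M I J * X J) = (if I = I\<^sub>0 then 1 else 0)" if I: "I \<in> ?A" for I
  proof -
    have "?M I J * X J = (if I = J then X J else 0) - fps_X * (fps_const (Tmat \<omega> a I J) * X J)" for J
      by (simp add: OneMinusZT_def fps_of_poly_pCons algebra_simps fps_const_neg[symmetric] del: fps_const_neg)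
    then have "(\<Sum>J\<in>?A. ?M I J * X J) = X I - fps_X * (\<Sum>J\<in>?A. fps_const (Tmat \<omega> a I J) * X J)"
      using I by (simp add: sum_subtractf sum_distrib_left)
    also have "\<dots> = (if I = I\<^sub>0 then 1 else 0)"
    proof (rule fps_ext)
      fix n
      show "fps_nth (X I - fps_X * (\<Sum>J\<in>?A. fps_const (Tmat \<omega> a I J) * X J)) n =
          fps_nth (if I = I\<^sub>0 then 1 else 0) n"
        using state_minor_0[OF I] state_minor_Suc[OF I]
        by (cases n) (simp_all add: X_def fps_sum_nth)
    qed
    finally show ?thesis .
  qed
  define n where "n = card ?A"
  obtain f where f: "bij_betw f {0..<n} ?A" "f 0 = I\<^sub>0"
    using ex_bij_betw_first[OF finite_Tidx I0_in_Tidx] unfolding n_def by blast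
  have n: "0 < n" using I0_in_Tidx by (auto simp: n_def card_gt_0_iff)
  let ?c = "cofactor (mat n n (\<lambda>(i, j). ?M (f i) (f j)))"
  have "det_on ?A ?M * X (f 0) = (\<Sum>j<n. ?c j 0 * (\<Sum>J\<in>?A. ?M (f j) J * X J))"
    by (rule det_on_mult_cofactors[OF f(1) n])
  also have "\<dots> = (\<Sum>j<n. if j = 0 then ?c 0 0 else 0)"
  proof (rule sum.cong[OF refl])
    fix j assume j: "j \<in> {..<n}"
    then have "f j \<in> ?A" using f(1) by (auto simp: bij_betw_def)
    moreover have "f j = I\<^sub>0 \<longleftrightarrow> j = 0"
      using bij_betw_imp_inj_on[OF f(1)] j n f(2) by (auto simp: inj_on_def)
    ultimately show "?c j 0 * (\<Sum>J\<in>?A. ?M (f j) J * X J) = (if j = 0 then ?c 0 0 else 0)"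
      using sol by simp
  qed
  also have "\<dots> = ?c 0 0" using n by simp
  also have "\<dots> = det_on (?A - {f 0}) ?M" by (rule cofactor_first_eq_det_on[OF f(1) n])
  finally have "fps_of_poly (Dpoly \<omega> a b) * X I\<^sub>0 = fps_of_poly (Npoly \<omega> a b)"
    by (simp add: Dpoly_def Npoly_def fps_of_poly_det_on f(2))
  moreover have "fps_of_poly (Dpoly \<omega> a b) \<noteq> 0"
    using Dpoly_nonzero fps_of_poly_eq_iff[of _ 0] by simp
  ultimately have "X I\<^sub>0 = fps_of_poly (Npoly \<omega> a b) / fps_of_poly (Dpoly \<omega> a b)"
    by (metis nonzero_mult_div_cancel_left)
  then show ?thesis by (simp add: X_def state_minor_I0)
qed

section \<open>Negative powers of the transfer matrix\<close>

text \<open>On \<open>Tidx a b\<close> this is \<open>T^(-m)\<close> applied to the unit vector at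
  \<open>I\<^sub>0\<close>.\<close>

definition retract_iter :: "nat \<Rightarrow> int set \<Rightarrow> 'a" where
  "retract_iter m = (retract ^^ m) unit_vec_I\<^sub>0"

lemma retract_iter_0: "retract_iter 0 I = (if I = I\<^sub>0 then 1 else 0)"
  and retract_iter_Suc: "retract_iter (Suc m) = retract (retract_iter m)"
  by (simp_all add: retract_iter_def)

lemma succ_image_eq_iff: "(\<lambda>x. x + 1) ` J = {l + 1..u + 1} \<longleftrightarrow> J = {l..u :: int}"
proof -
  have "inj (\<lambda>x :: int. x + 1)" by (simp add: inj_on_def)
  moreover have "{l + 1..u + 1} = (\<lambda>x. x + 1) ` {l..u}" by simp
  ultimately show ?thesis by (simp only: inj_image_eq_iff)
qed

text \<open>Until the supporting interval reaches \<open>-b\<close>, every reinsertion term of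
  \<open>retract\<close> is zero, so each step is a bare shift with the factor belonging to
  \<open>s = a\<close>.\<close>

lemma retract_iter_early:
  assumes "m \<le> nat b"
  shows "retract_iter m J = (if J = {- int m..a - 1 - int m} then (1 / ((- 1) ^ nat a * beta \<omega> a)) ^ m else 0)"
  using assms
proof (induction m arbitrary: J)
  case 0
  then show ?case by (simp add: retract_iter_0)
next
  case (Suc m)
  then have IH: "retract_iter m K =
      (if K = {- int m..a - 1 - int m} then (1 / ((- 1) ^ nat a * beta \<omega> a)) ^ m else 0)" for K
    by simp
  have m: "int m < b" using Suc.prems by simp
  have zero: "retract_iter m K = 0" if "- b \<in> K" for K
    using that m by (auto simp: IH)
  show ?case
  proof (cases "a - 1 \<in> J")
    case True
    then have "retract_iter (Suc m) J = 0" by (simp add: retract_iter_Suc retract_def Let_def zero)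
    moreover have "J \<noteq> {- int (Suc m)..a - 1 - int (Suc m)}" using True by auto
    ultimately show ?thesis by simp
  next
    case False
    then have "retract_iter (Suc m) J = retract_iter m ((\<lambda>x. x + 1) ` J) / ((- 1) ^ nat a * beta \<omega> a)"
      by (simp add: retract_iter_Suc retract_def Let_def zero)
    moreover have "(\<lambda>x. x + 1) ` J = {- int m..a - 1 - int m} \<longleftrightarrow>
        J = {- int (Suc m)..a - 1 - int (Suc m)}"
      using succ_image_eq_iff[of J "- int (Suc m)" "a - 1 - int (Suc m)"] by (simp add: algebra_simps)
    ultimately show ?thesis by (simp add: IH)
  qed
qed

text \<open>One more step reads only states contained in \<open>insert (-b) (J + 1)\<close>, so the
  run of elements starting at \<open>-b\<close> shrinks by at most one.\<close>

lemma retract_iter_support: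
  assumes "retract_iter (nat b + t) J \<noteq> 0"
  shows "{- b..a - 1 - b - int t} \<subseteq> J"
  using assms
proof (induction t arbitrary: J)
  case 0
  then show ?case using retract_iter_early[of "nat b" J] b_pos by (auto split: if_splits)
next
  case (Suc t)
  let ?K = "(\<lambda>x. x + 1) ` J"
  have shift: "{- b..a - 1 - b - int (Suc t)} \<subseteq> J"
    if "retract_iter (nat b + t) L \<noteq> 0" "L \<subseteq> insert (- b) ?K" for L
  proof
    fix x assume "x \<in> {- b..a - 1 - b - int (Suc t)}"
    then have "x + 1 \<in> {- b..a - 1 - b - int t}" "x + 1 \<noteq> - b" by auto
    with Suc.IH[OF that(1)] that(2) have "x + 1 \<in> ?K" by blast
    then show "x \<in> J" by auto
  qed
  have step: "retract_iter (nat b + Suc t) J = retract (retract_iter (nat b + t)) J"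
    by (simp add: retract_iter_Suc)
  show ?case
  proof (rule ccontr)
    assume "\<not> {- b..a - 1 - b - int (Suc t)} \<subseteq> J"
    then have zero: "retract_iter (nat b + t) L = 0" if "L \<subseteq> insert (- b) ?K" for L
      using shift that by blast
    \<comment> \<open>These are all the values that \<open>retract\<close> reads at
      \<open>J\<close>; its first branch is the case \<open>s = a\<close>.\<close>
    have "retract_iter (nat b + t) ?K = 0" "retract_iter (nat b + t) (insert (- b) (?K - {s})) = 0" for s
      by (rule zero; auto)+
    then have "retract (retract_iter (nat b + t)) J = 0" by (simp add: retract_def Let_def)
    with Suc.prems step show False by simp
  qed
qed

text \<open>Up to time \<open>b\<close> the supporting interval contains \<open>-m\<close>;
  afterwards the run at \<open>-b\<close> is nonempty while \<open>m < a + b\<close>. Both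
  contradict nonnegativity of \<open>I\<^sub>0\<close>.\<close>

lemma retract_iter_I0_eq_0:
  assumes "0 < m" "m < nat (a + b)"
  shows "retract_iter m I\<^sub>0 = 0"
proof (cases "m \<le> nat b")
  case True
  have "I\<^sub>0 \<noteq> {- int m..a - 1 - int m}"
  proof
    assume "I\<^sub>0 = {- int m..a - 1 - int m}"
    moreover have "- int m \<in> {- int m..a - 1 - int m}" using a_pos by simp
    ultimately show False using \<open>0 < m\<close> by auto
  qed
  then show ?thesis using retract_iter_early[OF True] by simp
next
  case False
  define t where "t = m - nat b"
  have t: "m = nat b + t" "int t < a" using False assms b_pos by (auto simp: t_def)
  show ?thesis
  proof (rule ccontr)
    assume "retract_iter m I\<^sub>0 \<noteq> 0"
    then have "{- b..a - 1 - b - int t} \<subseteq> I\<^sub>0" using retract_iter_support t(1) by blast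
    moreover have "- b \<in> {- b..a - 1 - b - int t}" using t(2) by simp
    ultimately show False using b_pos by auto
  qed
qed

text \<open>The returning path: in each step the element \<open>-b\<close> is put back at
  \<open>a\<close> and becomes \<open>a - 1\<close> after the shift. The new state contains
  \<open>a - 1\<close>, where \<open>retract\<close> has a single term, so nothing can
  cancel.\<close>

lemma retract_iter_rotated:
  assumes "int t \<le> a"
  shows "retract_iter (nat b + t) ({- b..a - 1 - b - int t} \<union> {a - int t..a - 1}) \<noteq> 0"
  using assms
proof (induction t)
  case 0
  then show ?case using retract_iter_early[of "nat b" "{- b..a - 1 - b}"] beta_max b_pos by simp
next
  case (Suc t)
  let ?J = "{- b..a - 1 - b - int (Suc t)} \<union> {a - int (Suc t)..a - 1}"
  have "(\<lambda>x. x + 1) ` ?J = {- b + 1..a - 1 - b - int t} \<union> {a - int t..a}"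
    by (simp add: image_Un algebra_simps)
  then have "insert (- b) ((\<lambda>x. x + 1) ` ?J - {a}) = {- b..a - 1 - b - int t} \<union> {a - int t..a - 1}"
    using Suc.prems b_pos by (simp only:) auto
  moreover have "a - 1 \<in> ?J" by simp
  ultimately have "retract_iter (nat b + Suc t) ?J =
      retract_iter (nat b + t) ({- b..a - 1 - b - int t} \<union> {a - int t..a - 1}) / beta \<omega> (- b)"
    by (simp only: add_Suc_right retract_iter_Suc retract_def Let_def if_True)
  then show ?case using Suc beta_min by simp
qed

lemma retract_iter_I0_nonzero: "retract_iter (nat (a + b)) I\<^sub>0 \<noteq> 0"
proof -
  have "nat (a + b) = nat b + nat a" using a_pos b_pos by (simp add: nat_add_distrib)
  moreover have "{- b..a - 1 - b - int (nat a)} \<union> {a - int (nat a)..a - 1} = I\<^sub>0"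
    using a_pos by auto
  ultimately show ?thesis using retract_iter_rotated[of "nat a"] a_pos by simp
qed

section \<open>Degree of the numerator\<close>

lemma OneMinusZT_monom:
  assumes "I \<in> Tidx a b"
  shows "(\<Sum>J\<in>Tidx a b. OneMinusZT \<omega> a I J * monom (v J) k) =
    monom (v I) k - monom (\<Sum>J\<in>Tidx a b. Tmat \<omega> a I J * v J) (Suc k)"
proof -
  have "OneMinusZT \<omega> a I J * monom (v J) k =
      (if I = J then monom (v J) k else 0) - monom (Tmat \<omega> a I J * v J) (Suc k)" for J
    by (simp add: OneMinusZT_def monom_Suc smult_monom minus_monom)
  then show ?thesis using assms by (simp add: sum_subtractf monom_sum)
qed

text \<open>The polynomial vector \<open>X = -\<Sum>\<^bsub>0<m\<le>L\<^esub> z\<^bsup>L-m\<^esup> \<^bold>T\<^bsup>-m\<^esup> e\<close> with \<open>L = a + b\<close> telescopes to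
  \<open>(1 - z\<^bold>T) X = z\<^bsup>L\<^esup> e - \<^bold>T\<^bsup>-L\<^esup> e\<close>, and its \<open>I\<^sub>0\<close> component is constant.\<close>

lemma degree_Npoly: "degree (Npoly \<omega> a b) + nat (a + b) = card (Tidx a b)"
proof -
  let ?A = "Tidx a b" and ?M = "OneMinusZT \<omega> a"
  define L where "L = nat (a + b)"
  have L: "0 < L" using a_pos b_pos by (simp add: L_def)
  define X where "X I = (\<Sum>m<L. monom (- retract_iter (Suc m) I) (L - Suc m))" for I
  have sol: "(\<Sum>J\<in>?A. ?M I J * X J) = monom (retract_iter 0 I) L - [:retract_iter L I:]" if I: "I \<in> ?A" for I
  proof -
    have "(\<Sum>J\<in>?A. ?M I J * X J) =
        (\<Sum>m<L. \<Sum>J\<in>?A. ?M I J * monom (- retract_iter (Suc m) J) (L - Suc m))"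
      unfolding X_def sum_distrib_left by (rule sum.swap)
    also have "\<dots> = (\<Sum>m<L. monom (retract_iter m I) (L - m) - monom (retract_iter (Suc m) I) (L - Suc m))"
    proof (rule sum.cong[OF refl])
      fix m assume "m \<in> {..<L}"
      then have m: "Suc (L - Suc m) = L - m" by auto
      have "(\<Sum>J\<in>?A. Tmat \<omega> a I J * - retract_iter (Suc m) J) = - retract_iter m I"
        using Tmat_retract[OF I, of "retract_iter m"] by (simp add: retract_iter_Suc sum_negf)
      then show "(\<Sum>J\<in>?A. ?M I J * monom (- retract_iter (Suc m) J) (L - Suc m)) =
          monom (retract_iter m I) (L - m) - monom (retract_iter (Suc m) I) (L - Suc m)"
        using OneMinusZT_monom[OF I, of "\<lambda>J. - retract_iter (Suc m) J" "L - Suc m"] m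
        by (simp add: minus_monom[symmetric])
    qed
    also have "\<dots> = monom (retract_iter 0 I) (L - 0) - monom (retract_iter L I) (L - L)"
      by (rule sum_lessThan_telescope')
    finally show ?thesis by (simp add: monom_0)
  qed
  \<comment> \<open>All terms but the last vanish by \<open>retract_iter_I0_eq_0\<close>.\<close>
  have X_I0: "X I\<^sub>0 = [:- retract_iter L I\<^sub>0:]"
  proof -
    have "X I\<^sub>0 = (\<Sum>m<L. if m = L - 1 then [:- retract_iter L I\<^sub>0:] else 0)"
      unfolding X_def
    proof (rule sum.cong[OF refl])
      fix m assume "m \<in> {..<L}"
      then show "monom (- retract_iter (Suc m) I\<^sub>0) (L - Suc m) = (if m = L - 1 then [:- retract_iter L I\<^sub>0:] else 0)"
        using retract_iter_I0_eq_0[of "Suc m"] by (auto simp: L_def monom_0)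
    qed
    then show ?thesis using L by simp
  qed
  define n where "n = card ?A"
  obtain f where f: "bij_betw f {0..<n} ?A" "f 0 = I\<^sub>0"
    using ex_bij_betw_first[OF finite_Tidx I0_in_Tidx] unfolding n_def by blast
  have n: "0 < n" using I0_in_Tidx by (auto simp: n_def card_gt_0_iff)
  define c where "c j = cofactor (mat n n (\<lambda>(i, j). ?M (f i) (f j))) j 0" for j
  have deg_c: "degree (c j) \<le> n - 1" if "j < n" for j
    unfolding c_def using that n
    by (intro degree_cofactor_le) (auto simp del: One_nat_def intro: degree_OneMinusZT)
  have "Dpoly \<omega> a b * X I\<^sub>0 = (\<Sum>j<n. c j * (\<Sum>J\<in>?A. ?M (f j) J * X J))"
    using det_on_mult_cofactors[OF f(1) n, of ?M X] by (simp add: Dpoly_def c_def f(2))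
  also have "\<dots> = (\<Sum>j<n. (if j = 0 then c 0 * monom 1 L else 0) - c j * [:retract_iter L (f j):])"
  proof (rule sum.cong[OF refl])
    fix j assume j: "j \<in> {..<n}"
    then have "f j \<in> ?A" using f(1) by (auto simp: bij_betw_def)
    moreover have "f j = I\<^sub>0 \<longleftrightarrow> j = 0"
      using bij_betw_imp_inj_on[OF f(1)] j n f(2) by (auto simp: inj_on_def)
    ultimately show "c j * (\<Sum>J\<in>?A. ?M (f j) J * X J) =
        (if j = 0 then c 0 * monom 1 L else 0) - c j * [:retract_iter L (f j):]"
      using sol by (simp add: retract_iter_0 right_diff_distrib)
  qed
  also have "\<dots> = c 0 * monom 1 L - (\<Sum>j<n. c j * [:retract_iter L (f j):])"
    using n by (simp add: sum_subtractf)
  also have "c 0 = Npoly \<omega> a b"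
    using cofactor_first_eq_det_on[OF f(1) n, of ?M] by (simp add: c_def Npoly_def f(2))
  \<comment> \<open>The first summand is a nonzero constant times D, of degree \<open>n\<close>; the
    cofactor terms have degree at most \<open>n - 1\<close>, so they cannot cancel its leading
    term.\<close>
  finally have eq: "Npoly \<omega> a b * monom 1 L =
      Dpoly \<omega> a b * [:- retract_iter L I\<^sub>0:] + (\<Sum>j<n. c j * [:retract_iter L (f j):])"
    by (simp add: X_I0)
  have D: "degree (Dpoly \<omega> a b * [:- retract_iter L I\<^sub>0:]) = n"
    using degree_Dpoly retract_iter_I0_nonzero by (simp add: L_def n_def)
  have "degree (\<Sum>j<n. c j * [:retract_iter L (f j):]) \<le> n - 1"
    by (intro degree_sum_le) (use deg_c in \<open>auto intro: order.trans[OF degree_smult_le]\<close>)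
  then have "degree (Npoly \<omega> a b * monom 1 L) = n"
    unfolding eq using D n by (subst degree_add_eq_left) linarith+
  moreover have "Npoly \<omega> a b \<noteq> 0"
    using calculation n by auto
  ultimately show ?thesis
    by (simp add: degree_mult_eq degree_monom_eq L_def n_def)
qed

end

theorem mainTheorem5:
  fixes S :: "int set" and \<omega> :: "int \<Rightarrow> 'a::field_char_0"
  assumes "finite S" and "S \<noteq> {}"
    and "Max S \<ge> 1" and "- Min S \<ge> 1"
    and "\<And>s. s \<notin> S \<Longrightarrow> \<omega> s = 0"
    and "\<omega> (Max S) \<noteq> 0" and "\<omega> (Min S) \<noteq> 0"
  shows "Abs_fps (Fk \<omega>) = fps_of_poly (Npoly \<omega> (Max S) (- Min S)) / fps_of_poly (Dpoly \<omega> (Max S) (- Min S))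
    \<and> degree (Dpoly \<omega> (Max S) (- Min S)) = (nat (Max S + - Min S)) choose (nat (Max S))
    \<and> int (degree (Npoly \<omega> (Max S) (- Min S)))
           = int ((nat (Max S + - Min S)) choose (nat (Max S))) - (Max S + - Min S)"
proof -
  interpret walk \<omega> "Max S" "- Min S"
  proof
    fix s assume "s < - (- Min S) \<or> Max S < s"
    then have "s \<notin> S"
      using Min_le[OF assms(1), of s] Max_ge[OF assms(1), of s] by linarith
    then show "\<omega> s = 0" by (rule assms(5))
  qed (simp_all only: minus_minus assms simp_thms)
  have card: "card (Tidx (Max S) (- Min S)) = nat (Max S + - Min S) choose nat (Max S)"
    using assms by (intro card_Tidx) auto
  \<comment> \<open>The additive relation on naturals is moved to the integers, where subtraction
    does not truncate.\<close>
  have "int (degree (Npoly \<omega> (Max S) (- Min S))) + int (nat (Max S + - Min S)) =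
      int (card (Tidx (Max S) (- Min S)))"
    using degree_Npoly by (metis of_nat_add)
  then show ?thesis
    using generating_function degree_Dpoly card assms(3,4) by simp
qed

end
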